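(* Let $f_1\in\mathcal F_{\mu_1,L_1}$ and $f_2\in\mathcal F_{\mu_2,L_2}$ be functions on $\mathbb R^d$ satisfying the standing assumption (A) of the context, with $L_2>\mu_1\ge\mu_2\ge 0$, and let $F=f_1-f_2$. Then after two DCA iterations connecting $x^k$, $x^{k+1}$ and $x^{k+2}$ (with $x^k\in\operatorname{dom}\partial f_1$) it holds $$F(x^k)-F(x^{k+1})\;\ge\;\Big(\mu_1+\mu_2\frac{L_2-\mu_1}{L_2-\mu_2}\Big)\frac12\|x^k-x^{k+1}\|^2+\mu_1\frac{\mu_1-\mu_2}{L_2-\mu_2}\,\frac12\|x^{k+1}-x^{k+2}\|^2 .$$
   Context: Function class. For $\mu\in\mathbb R$ and $L\in(\mu,\infty]$, $\mathcal F_{\mu,L}$ denotes the set of proper, lower semicontinuous functions $f:\mathbb R^d\to\mathbb R\cup\{+\infty\}$ such that $f-\frac{\mu}{2}\|\cdot\|^2$ is convex and, if $L<\infty$, $f$ is finite-valued and $\frac L2\|\cdot\|^2-f$ is convex (no condition on the upper curvature if $L=\infty$). Expressions in which some $L_i=\infty$ are understood as limits $L_i\to\infty$. Subdifferential. For convex $f$, $\partial f(x)$ is the usual convex subdifferential. For $f\in\mathcal F_{\mu,L}$ with $\mu<0$, $\partial f(x):=\partial\tilde f(x)+\mu x$ where $\tilde f=f-\frac\mu2\|\cdot\|^2$ is convex. $\operatorname{dom}\partial f=\{x:\partial f(x)\ne\emptyset\}$ and $\operatorname{range}\partial f=\bigcup_x\partial f(x)$. Standing assumption (A). $f_1\in\mathcal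 F_{\mu_1,L_1}$ and $f_2\in\mathcal F_{\mu_2,L_2}$ with $0\le\mu_1<L_1\le\infty$, $\mu_2\in(-\infty,\infty)$, $L_2\in(\mu_2,\infty]$; $F=f_1-f_2$ (with the convention $(+\infty)-(+\infty)=+\infty$) is bounded below; $\emptyset\ne\operatorname{dom}\partial f_1\subseteq\operatorname{dom}\partial f_2$ and $\operatorname{range}\partial f_2\subseteq\operatorname{range}\partial f_1$. DCA (difference-of-convex algorithm). Given $x^k$, one iteration selects any $g_2^k\in\partial f_2(x^k)$ and any $x^{k+1}\in\arg\min_{w\in\mathbb R^d}\{f_1(w)-\langle g_2^k,w\rangle\}$. *)

theory Defs
  imports "HOL-Analysis.Analysis"
begin

text \<open>
  Functions into the reals extended by plus infinity are modelled with codomain \<^typ>\<open>ereal\<close>;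
  the value minus infinity is excluded by properness.
\<close>

definition proper :: "('a \<Rightarrow> ereal) \<Rightarrow> bool" where
  "proper f \<longleftrightarrow> (\<forall>x. f x \<noteq> -\<infinity>) \<and> (\<exists>x. f x \<noteq> \<infinity>)"

definition lower_semicontinuous :: "('a::topological_space \<Rightarrow> ereal) \<Rightarrow> bool" where
  "lower_semicontinuous f \<longleftrightarrow> (\<forall>x. f x \<le> Liminf (at x) f)"

text \<open>
  The library's \<^const>\<open>convex_on\<close> needs real values. In the type \<^typ>\<open>ereal\<close> zero times infinity is
  zero, so the inequality below holds trivially at both endpoints of the range of \<open>t\<close>.
\<close>

definition ereal_convex :: "('a::real_vector \<Rightarrow> ereal) \<Rightarrow> bool" where
  "ereal_convex f \<longleftrightarrow>
     (\<forall>x y. \<forall>t\<in>{0..1::real}.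
        f ((1 - t) *\<^sub>R x + t *\<^sub>R y) \<le> ereal (1 - t) * f x + ereal t * f y)"

definition curvature_class :: "real \<Rightarrow> ereal \<Rightarrow> ('a::euclidean_space \<Rightarrow> ereal) set" where
  "curvature_class \<mu> L =
     {f. proper f \<and> lower_semicontinuous f \<and>
         ereal_convex (\<lambda>x. f x - ereal (\<mu> / 2 * (norm x)\<^sup>2)) \<and>
         (L < \<infinity> \<longrightarrow>
            (\<forall>x. \<bar>f x\<bar> \<noteq> \<infinity>) \<and>
            ereal_convex (\<lambda>x. ereal (real_of_ereal L / 2 * (norm x)\<^sup>2) - f x))}"

definition convex_subdiff :: "('a::euclidean_space \<Rightarrow> ereal) \<Rightarrow> 'a \<Rightarrow> 'a set" where
  "convex_subdiff f x = {g. \<forall>y. f x + ereal (g \<bullet> (y - x)) \<le> f y}"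

text \<open>
  The parameter \<open>\<mu>\<close> is the lower curvature of the class that \<open>f\<close> is taken from. For negative \<open>\<mu>\<close> the
  subdifferential is the convex one of \<open>f\<close> minus \<open>\<mu>/2\<close> times the squared norm, shifted by \<open>\<mu> x\<close>.
\<close>

definition subdiff :: "real \<Rightarrow> ('a::euclidean_space \<Rightarrow> ereal) \<Rightarrow> 'a \<Rightarrow> 'a set" where
  "subdiff \<mu> f x =
     (if 0 \<le> \<mu> then convex_subdiff f x
      else (\<lambda>g. g + \<mu> *\<^sub>R x) ` convex_subdiff (\<lambda>z. f z - ereal (\<mu> / 2 * (norm z)\<^sup>2)) x)"

definition dom_subdiff :: "real \<Rightarrow> ('a::euclidean_space \<Rightarrow> ereal) \<Rightarrow> 'a set" where
  "dom_subdiff \<mu> f = {x. subdiff \<mu> f x \<noteq> {}}"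

definition range_subdiff :: "real \<Rightarrow> ('a::euclidean_space \<Rightarrow> ereal) \<Rightarrow> 'a set" where
  "range_subdiff \<mu> f = (\<Union>x. subdiff \<mu> f x)"

text \<open>
  Subtraction on \<^typ>\<open>ereal\<close> satisfies \<open>\<infinity> - \<infinity> = \<infinity>\<close>, which is the convention for the objective.
\<close>

definition dc_objective :: "('a \<Rightarrow> ereal) \<Rightarrow> ('a \<Rightarrow> ereal) \<Rightarrow> 'a \<Rightarrow> ereal" where
  "dc_objective f1 f2 x = f1 x - f2 x"

definition standing_assumption ::
  "real \<Rightarrow> ereal \<Rightarrow> ('a::euclidean_space \<Rightarrow> ereal) \<Rightarrow> real \<Rightarrow> ereal \<Rightarrow> ('a \<Rightarrow> ereal) \<Rightarrow> bool" where
  "standing_assumption \<mu>1 L1 f1 \<mu>2 L2 f2 \<longleftrightarrow>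
     0 \<le> \<mu>1 \<and> ereal \<mu>1 < L1 \<and> ereal \<mu>2 < L2 \<and>
     f1 \<in> curvature_class \<mu>1 L1 \<and> f2 \<in> curvature_class \<mu>2 L2 \<and>
     (\<exists>m::real. \<forall>x. ereal m \<le> dc_objective f1 f2 x) \<and>
     dom_subdiff \<mu>1 f1 \<noteq> {} \<and>
     dom_subdiff \<mu>1 f1 \<subseteq> dom_subdiff \<mu>2 f2 \<and>
     range_subdiff \<mu>2 f2 \<subseteq> range_subdiff \<mu>1 f1"

definition dca_step ::
  "('a::euclidean_space \<Rightarrow> ereal) \<Rightarrow> real \<Rightarrow> ('a \<Rightarrow> ereal) \<Rightarrow> 'a \<Rightarrow> 'a \<Rightarrow> bool" where
  "dca_step f1 \<mu>2 f2 x x' \<longleftrightarrow>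
     (\<exists>g\<in>subdiff \<mu>2 f2 x. is_arg_min (\<lambda>w. f1 w - ereal (g \<bullet> w)) (\<lambda>_. True) x')"

text \<open>
  Value at \<open>L\<close> of an expression \<open>\<phi>\<close> in an upper curvature; at infinity it is the limit of \<open>\<phi>\<close>.
\<close>

definition curvature_eval :: "(real \<Rightarrow> real) \<Rightarrow> ereal \<Rightarrow> real" where
  "curvature_eval \<phi> L = (if L = \<infinity> then Lim at_top \<phi> else \<phi> (real_of_ereal L))"

end

theory Submission
  imports Defs "HOL-Real_Asymp.Real_Asymp"
begin

text \<open>
  Write \<open>g0 \<in> \<partial>f2(x0) \<inter> \<partial>f1(x1)\<close> and \<open>g1 \<in> \<partial>f2(x1) \<inter> \<partial>f1(x2)\<close> for the subgradients selected by the
  two steps, and put \<open>a = x1 - x0\<close>, \<open>b = x2 - x1\<close>, \<open>h = g1 - g0\<close>. Strong convexity of \<open>f1\<close> between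
  \<open>x0\<close> and \<open>x1\<close> and the interpolation inequality of the class of \<open>f2\<close> add up to
  \<open>F(x0) - F(x1) \<ge> (\<mu>1 + \<mu>2)/2 |a|^2 + |h - \<mu>2 a|^2 / (2 (L2 - \<mu>2))\<close>. Strong monotonicity of \<open>\<partial>f1\<close>
  gives \<open>|h| \<ge> \<mu>1 |b|\<close>, and minimising over \<open>a\<close> the quadratic \<open>|h - \<mu>2 a|^2 + \<mu>2 (\<mu>1 - \<mu>2) |a|^2\<close>
  (minimiser \<open>a = h / \<mu>1\<close>) yields the term in \<open>|b|^2\<close>.
\<close>

section \<open>Subgradients of proper functions\<close>

lemma convex_subdiff_finite:
  assumes "proper f" and "g \<in> convex_subdiff f x"
  shows "\<bar>f x\<bar> \<noteq> \<infinity>"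
proof -
  obtain y where "f y \<noteq> \<infinity>" using assms(1) by (auto simp: proper_def)
  moreover have "f x + ereal (g \<bullet> (y - x)) \<le> f y"
    using assms(2) by (auto simp: convex_subdiff_def)
  moreover have "f x \<noteq> -\<infinity>" using assms(1) by (auto simp: proper_def)
  ultimately show ?thesis by (cases "f x"; cases "f y") auto
qed

text \<open>Minimality of \<open>x\<close> rearranges into the subgradient inequality. This places
  the subgradient of \<open>f2\<close> selected by a DCA step in the subdifferential of
  \<open>f1\<close> at the new iterate.\<close>

lemma is_arg_min_imp_convex_subdiff:
  assumes "proper f" and "is_arg_min (\<lambda>w. f w - ereal (g \<bullet> w)) (\<lambda>_. True) x"
  shows "g \<in> convex_subdiff f x"
  unfolding convex_subdiff_def
proof safe
  fix y
  have "f x - ereal (g \<bullet> x) \<le> f y - ereal (g \<bullet> y)"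
    using assms(2) by (auto simp: is_arg_min_def not_less)
  moreover have "f x \<noteq> -\<infinity>" "f y \<noteq> -\<infinity>" using assms(1) by (auto simp: proper_def)
  ultimately show "f x + ereal (g \<bullet> (y - x)) \<le> f y"
    by (cases "f x"; cases "f y") (auto simp: inner_diff_right)
qed

section \<open>Quadratic inequalities from curvature bounds\<close>

lemma le_of_forall_small_mult:
  fixes c k d :: real
  assumes "\<And>t. 0 < t \<Longrightarrow> t < 1 \<Longrightarrow> c \<le> d + t * k"
  shows "c \<le> d"
proof (rule tendsto_lowerbound)
  show "((\<lambda>t. d + t * k) \<longlongrightarrow> d) (at_right 0)" by (auto intro!: tendsto_eq_intros)
  show "\<forall>\<^sub>F t in at_right 0. c \<le> d + t * k"
    unfolding eventually_at_right_field using assms by (intro exI[of _ 1]) auto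
qed auto

lemma norm_convex_combination_sq:
  fixes x y :: "'a::real_inner"
  shows "(norm ((1 - t) *\<^sub>R x + t *\<^sub>R y))\<^sup>2
    = (1 - t) * (norm x)\<^sup>2 + t * (norm y)\<^sup>2 - t * (1 - t) * (norm (y - x))\<^sup>2"
  unfolding power2_norm_eq_inner
  by (simp add: inner_add_left inner_add_right inner_diff_left inner_diff_right inner_commute
      algebra_simps power2_eq_square)

text \<open>At a point of the segment from \<open>x\<close> to \<open>y\<close>, the subgradient
  bound from below meets the bound from above given by convexity of \<open>f\<close> minus the
  quadratic. Dividing by \<open>t\<close> and letting \<open>t\<close> tend to 0 gives the
  claim.\<close>

lemma strongly_convex_subgradient_ineq:
  fixes f :: "'a::euclidean_space \<Rightarrow> ereal"
  assumes "proper f" and conv: "ereal_convex (\<lambda>x. f x - ereal (\<mu> / 2 * (norm x)\<^sup>2))"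
    and g: "g \<in> convex_subdiff f x"
  shows "f x + ereal (g \<bullet> (y - x) + \<mu> / 2 * (norm (y - x))\<^sup>2) \<le> f y"
proof (cases "f y = \<infinity>")
  case False
  then obtain b where b: "f y = ereal b"
    using assms(1) by (cases "f y") (auto simp: proper_def)
  obtain a where a: "f x = ereal a"
    using convex_subdiff_finite[OF assms(1) g] by auto
  let ?q = "\<mu> / 2 * (norm (y - x))\<^sup>2"
  have "a + g \<bullet> (y - x) + ?q \<le> b + t * ?q" if t: "0 < t" "t < 1" for t
  proof -
    let ?w = "(1 - t) *\<^sub>R x + t *\<^sub>R y"
    have "?w - x = t *\<^sub>R (y - x)" by (simp add: algebra_simps)
    moreover have "f x + ereal (g \<bullet> (?w - x)) \<le> f ?w"
      using g unfolding convex_subdiff_def by blast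
    ultimately have lower: "ereal (a + t * (g \<bullet> (y - x))) \<le> f ?w" using a by simp
    have upper: "f ?w - ereal (\<mu> / 2 * (norm ?w)\<^sup>2)
      \<le> ereal (1 - t) * (f x - ereal (\<mu> / 2 * (norm x)\<^sup>2))
        + ereal t * (f y - ereal (\<mu> / 2 * (norm y)\<^sup>2))"
      using conv t unfolding ereal_convex_def by auto
    obtain c where c: "f ?w = ereal c"
      using lower upper by (cases "f ?w") (auto simp: a b)
    have "a + t * (g \<bullet> (y - x)) \<le> c" using lower c by simp
    also have "c \<le> (1 - t) * (a - \<mu> / 2 * (norm x)\<^sup>2) + t * (b - \<mu> / 2 * (norm y)\<^sup>2)
        + \<mu> / 2 * (norm ?w)\<^sup>2"
      using upper unfolding c a b by simp
    \<comment> \<open>The squared norms cancel up to the defect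
      \<open>t * (1 - t) * (norm (y - x))^2\<close>, so a factor \<open>t\<close> splits
      off.\<close>
    also have "\<dots> = a + t * (b - a - (1 - t) * ?q)"
      unfolding norm_convex_combination_sq by (simp add: field_simps)
    finally have "t * (g \<bullet> (y - x)) \<le> t * (b - a - (1 - t) * ?q)" by simp
    then have "g \<bullet> (y - x) \<le> b - a - (1 - t) * ?q" using t by simp
    then show ?thesis by (simp add: algebra_simps diff_divide_distrib)
  qed
  then have "a + g \<bullet> (y - x) + ?q \<le> b" by (rule le_of_forall_small_mult)
  then show ?thesis using a b by (simp add: add.assoc)
qed simp

text \<open>
  No differentiability is needed: \<open>x\<close> lies between \<open>y\<close> and the reflected point \<open>x - t (y - x)\<close>, and
  the subgradient inequality bounds \<open>f\<close> from below at the latter.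
\<close>

lemma upper_curvature_subgradient_ineq:
  fixes f :: "'a::euclidean_space \<Rightarrow> ereal"
  assumes fin: "\<And>x. \<bar>f x\<bar> \<noteq> \<infinity>"
    and conv: "ereal_convex (\<lambda>x. ereal (L / 2 * (norm x)\<^sup>2) - f x)"
    and g: "g \<in> convex_subdiff f x"
  shows "f y \<le> f x + ereal (g \<bullet> (y - x) + L / 2 * (norm (y - x))\<^sup>2)"
proof -
  define r where "r z = real_of_ereal (f z)" for z
  have f: "f z = ereal (r z)" for z using fin[of z] by (auto simp: r_def ereal_real')
  let ?q = "L / 2 * (norm (y - x))\<^sup>2"
  have "r y \<le> (r x + g \<bullet> (y - x) + ?q) + t * ?q" if t: "0 < t" "t < 1" for t
  proof -
    \<comment> \<open>\<open>?s\<close> is the weight on \<open>y\<close> that makes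
      \<open>x\<close> the convex combination of \<open>?w\<close> and \<open>y\<close>. Multiplying
      by \<open>1 + t\<close> clears its denominator.\<close>
    let ?w = "x - t *\<^sub>R (y - x)" and ?s = "t / (1 + t)"
    have eq: "(1 - ?s) *\<^sub>R ?w + ?s *\<^sub>R y = x"
    proof -
      have "(1 + t) *\<^sub>R ((1 - ?s) *\<^sub>R ?w + ?s *\<^sub>R y) = ((1 + t) * (1 - ?s)) *\<^sub>R ?w + ((1 + t) * ?s) *\<^sub>R y"
        by (simp only: scaleR_add_right scaleR_scaleR)
      also have "(1 + t) * (1 - ?s) = 1" using t by (simp add: field_simps)
      also have "(1 + t) * ?s = t" using t by simp
      also have "1 *\<^sub>R ?w + t *\<^sub>R y = (1 + t) *\<^sub>R x" by (simp add: algebra_simps)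
      finally show ?thesis using t by simp
    qed
    have "0 \<le> ?s" "?s \<le> 1" using t by auto
    then have "ereal (L / 2 * (norm x)\<^sup>2) - f x
        \<le> ereal (1 - ?s) * (ereal (L / 2 * (norm ?w)\<^sup>2) - f ?w)
          + ereal ?s * (ereal (L / 2 * (norm y)\<^sup>2) - f y)"
      using conv eq unfolding ereal_convex_def by (metis atLeastAtMost_iff)
    then have "L / 2 * (norm x)\<^sup>2 - r x
        \<le> (1 - ?s) * (L / 2 * (norm ?w)\<^sup>2 - r ?w) + ?s * (L / 2 * (norm y)\<^sup>2 - r y)"
      unfolding f by simp
    then have "(1 + t) * (L / 2 * (norm x)\<^sup>2 - r x)
        \<le> (1 + t) * ((1 - ?s) * (L / 2 * (norm ?w)\<^sup>2 - r ?w) + ?s * (L / 2 * (norm y)\<^sup>2 - r y))"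
      using t by (intro mult_left_mono) auto
    also have "\<dots> = ((1 + t) * (1 - ?s)) * (L / 2 * (norm ?w)\<^sup>2 - r ?w)
        + ((1 + t) * ?s) * (L / 2 * (norm y)\<^sup>2 - r y)"
      by (simp only: distrib_left mult.assoc)
    also have "(1 + t) * (1 - ?s) = 1" using t by (simp add: field_simps)
    also have "(1 + t) * ?s = t" using t by simp
    finally have conv': "(1 + t) * (L / 2 * (norm x)\<^sup>2 - r x)
        \<le> (L / 2 * (norm ?w)\<^sup>2 - r ?w) + t * (L / 2 * (norm y)\<^sup>2 - r y)" by simp
    have "f x + ereal (g \<bullet> (?w - x)) \<le> f ?w"
      using g unfolding convex_subdiff_def by blast
    then have lower: "r x - t * (g \<bullet> (y - x)) \<le> r ?w" unfolding f by simp
    have nw: "L / 2 * (norm ?w)\<^sup>2 + t * (L / 2 * (norm y)\<^sup>2)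
        = (1 + t) * (L / 2 * (norm x)\<^sup>2) + t * ((1 + t) * ?q)"
      unfolding power2_norm_eq_inner
      by (simp add: inner_diff_left inner_diff_right inner_commute algebra_simps add_divide_distrib)
    have "t * r y \<le> t * (r x + g \<bullet> (y - x) + (1 + t) * ?q)"
      using conv' lower nw by (simp add: algebra_simps)
    then have "r y \<le> r x + g \<bullet> (y - x) + (1 + t) * ?q" using t by simp
    then show ?thesis by (simp add: algebra_simps add_divide_distrib)
  qed
  then have "r y \<le> r x + g \<bullet> (y - x) + ?q" by (rule le_of_forall_small_mult)
  then show ?thesis unfolding f by (simp add: add.assoc)
qed

text \<open>At any point \<open>z\<close>, the lower quadratic bound with curvature \<mu> built at
  \<open>x\<close> lies below the upper one with curvature \<open>L\<close> built at
  \<open>y\<close>. The best choice of \<open>z\<close> leaves the squared norm as the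
  surplus.\<close>

lemma curvature_class_interpolation_ineq:
  fixes f :: "'a::euclidean_space \<Rightarrow> ereal"
  assumes f: "f \<in> curvature_class \<mu> (ereal L)" and "\<mu> < L"
    and u: "u \<in> convex_subdiff f x" and v: "v \<in> convex_subdiff f y"
  shows "f x + ereal (u \<bullet> (y - x) + \<mu> / 2 * (norm (y - x))\<^sup>2
      + (norm (v - u - \<mu> *\<^sub>R (y - x)))\<^sup>2 / (2 * (L - \<mu>))) \<le> f y"
proof -
  define e where "e = v - u - \<mu> *\<^sub>R (y - x)"
  define d where "d = (1 / (L - \<mu>)) *\<^sub>R e"
  \<comment> \<open>The point where the upper bound from \<open>y\<close> minus the lower bound from \<open>x\<close> is smallest.\<close>
  define z where "z = y - d"
  have fin: "\<bar>f w\<bar> \<noteq> \<infinity>" for w using f by (auto simp: curvature_class_def)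
  have lower: "f x + ereal (u \<bullet> (z - x) + \<mu> / 2 * (norm (z - x))\<^sup>2) \<le> f z"
    using f u by (intro strongly_convex_subgradient_ineq) (auto simp: curvature_class_def)
  have upper: "f z \<le> f y + ereal (v \<bullet> (z - y) + L / 2 * (norm (z - y))\<^sup>2)"
    using f v by (intro upper_curvature_subgradient_ineq) (auto simp: curvature_class_def)
  obtain a b where ab: "f x = ereal a" "f y = ereal b"
    using fin[of x] fin[of y] by auto
  have "f x + ereal (u \<bullet> (z - x) + \<mu> / 2 * (norm (z - x))\<^sup>2)
      \<le> f y + ereal (v \<bullet> (z - y) + L / 2 * (norm (z - y))\<^sup>2)"
    using lower upper by (rule order_trans)
  then have "a + u \<bullet> (z - x) + \<mu> / 2 * (norm (z - x))\<^sup>2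
      \<le> b + v \<bullet> (z - y) + L / 2 * (norm (z - y))\<^sup>2"
    unfolding ab by simp
  \<comment> \<open>The terms in \<open>d\<close> form the concave quadratic
    \<open>e \<bullet> d - (L - \<mu>) / 2 * (d \<bullet> d)\<close>, which is largest at
    \<open>d = e / (L - \<mu>)\<close>.\<close>
  moreover have "u \<bullet> (z - x) + \<mu> / 2 * (norm (z - x))\<^sup>2 - v \<bullet> (z - y) - L / 2 * (norm (z - y))\<^sup>2
      = u \<bullet> (y - x) + \<mu> / 2 * (norm (y - x))\<^sup>2 + e \<bullet> d - (L - \<mu>) / 2 * (d \<bullet> d)"
    unfolding power2_norm_eq_inner z_def e_def
    by (simp add: inner_diff_left inner_diff_right inner_add_left inner_add_right inner_commute
        algebra_simps add_divide_distrib diff_divide_distrib)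
  moreover have "e \<bullet> d - (L - \<mu>) / 2 * (d \<bullet> d) = (norm e)\<^sup>2 / (2 * (L - \<mu>))"
  proof -
    obtain M where "L - \<mu> = M" "M > 0" using \<open>\<mu> < L\<close> by simp
    then show ?thesis unfolding power2_norm_eq_inner d_def by (simp add: field_simps)
  qed
  ultimately have "a + u \<bullet> (y - x) + \<mu> / 2 * (norm (y - x))\<^sup>2 + (norm e)\<^sup>2 / (2 * (L - \<mu>)) \<le> b"
    by linarith
  then show ?thesis unfolding ab e_def by (simp add: add.assoc)
qed

text \<open>Adding the strong convexity inequalities in both directions yields strong monotonicity
  of the subdifferential; Cauchy-Schwarz then cancels one factor
  \<open>norm (y - x)\<close>.\<close>

lemma strongly_convex_subgradient_expansion:
  fixes f :: "'a::euclidean_space \<Rightarrow> ereal"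
  assumes "proper f" and "ereal_convex (\<lambda>x. f x - ereal (\<mu> / 2 * (norm x)\<^sup>2))"
    and g: "g \<in> convex_subdiff f x" and h: "h \<in> convex_subdiff f y"
  shows "\<mu> * norm (y - x) \<le> norm (h - g)"
proof -
  obtain a b where ab: "f x = ereal a" "f y = ereal b"
    using convex_subdiff_finite[OF assms(1) g] convex_subdiff_finite[OF assms(1) h] by auto
  have "a + g \<bullet> (y - x) + \<mu> / 2 * (norm (y - x))\<^sup>2 \<le> b"
    using strongly_convex_subgradient_ineq[OF assms(1,2) g, of y] unfolding ab by simp
  moreover have "b + h \<bullet> (x - y) + \<mu> / 2 * (norm (y - x))\<^sup>2 \<le> a"
    using strongly_convex_subgradient_ineq[OF assms(1,2) h, of x] unfolding ab
    by (simp add: norm_minus_commute)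
  ultimately have "\<mu> * (norm (y - x))\<^sup>2 \<le> (h - g) \<bullet> (y - x)"
    by (simp add: inner_diff_left inner_diff_right)
  also have "\<dots> \<le> norm (h - g) * norm (y - x)" by (rule norm_cauchy_schwarz)
  finally have "(\<mu> * norm (y - x)) * norm (y - x) \<le> norm (h - g) * norm (y - x)"
    by (simp add: power2_eq_square mult.assoc)
  then show ?thesis by (cases "y = x") simp_all
qed

text \<open>For positive \<mu>, completing the square writes \<mu> times the right side as
  \<open>(\<mu> - \<nu>) * (norm h)^2\<close> plus a nonnegative square that vanishes at
  \<open>a = h / \<mu>\<close>.\<close>

lemma norm_diff_scaled_sq_lower_bound:
  fixes a h :: "'a::real_inner"
  assumes "0 \<le> \<nu>" "\<nu> \<le> \<mu>" "0 \<le> s" "\<mu> * s \<le> norm h"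
  shows "\<mu> * (\<mu> - \<nu>) * s\<^sup>2 \<le> (norm (h - \<nu> *\<^sub>R a))\<^sup>2 + \<nu> * (\<mu> - \<nu>) * (norm a)\<^sup>2"
proof (cases "\<mu> = 0")
  case False
  then have \<mu>: "\<mu> > 0" using assms by simp
  have "\<mu> * ((norm (h - \<nu> *\<^sub>R a))\<^sup>2 + \<nu> * (\<mu> - \<nu>) * (norm a)\<^sup>2)
      = (\<mu> - \<nu>) * (norm h)\<^sup>2 + \<nu> * (norm (h - \<mu> *\<^sub>R a))\<^sup>2"
    unfolding power2_norm_eq_inner
    by (simp add: inner_diff_left inner_diff_right inner_commute algebra_simps)
  moreover have "(\<mu> - \<nu>) * (\<mu> * s)\<^sup>2 \<le> (\<mu> - \<nu>) * (norm h)\<^sup>2"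
    using assms \<mu> by (intro mult_left_mono power_mono) auto
  moreover have "0 \<le> \<nu> * (norm (h - \<mu> *\<^sub>R a))\<^sup>2" using assms by simp
  moreover have "(\<mu> - \<nu>) * (\<mu> * s)\<^sup>2 = \<mu> * (\<mu> * (\<mu> - \<nu>) * s\<^sup>2)"
    by (simp add: power2_eq_square)
  ultimately have "\<mu> * (\<mu> * (\<mu> - \<nu>) * s\<^sup>2)
      \<le> \<mu> * ((norm (h - \<nu> *\<^sub>R a))\<^sup>2 + \<nu> * (\<mu> - \<nu>) * (norm a)\<^sup>2)" by linarith
  then show ?thesis using \<mu> by simp
qed (use assms in simp)

section \<open>The two-step descent estimate\<close>

lemma curvature_eval_ereal [simp]: "curvature_eval \<phi> (ereal L) = \<phi> L"
  by (simp add: curvature_eval_def)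

lemma curvature_eval_infinity:
  "(\<phi> \<longlongrightarrow> c) at_top \<Longrightarrow> curvature_eval \<phi> \<infinity> = c"
  by (simp add: curvature_eval_def tendsto_Lim)

theorem lemma2:
  fixes f1 f2 :: "real ^ 'n \<Rightarrow> ereal"
    and \<mu>1 \<mu>2 :: real
    and L1 L2 :: ereal
    and x0 x1 x2 :: "real ^ 'n"
  assumes "standing_assumption \<mu>1 L1 f1 \<mu>2 L2 f2"
    and "L2 > ereal \<mu>1" and "\<mu>1 \<ge> \<mu>2" and "\<mu>2 \<ge> 0"
    and "x0 \<in> dom_subdiff \<mu>1 f1"
    and "dca_step f1 \<mu>2 f2 x0 x1"
    and "dca_step f1 \<mu>2 f2 x1 x2"
  shows "dc_objective f1 f2 x0 - dc_objective f1 f2 x1 \<ge>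
    ereal (curvature_eval
      (\<lambda>L. (\<mu>1 + \<mu>2 * ((L - \<mu>1) / (L - \<mu>2))) * (1/2 * (norm (x0 - x1))\<^sup>2)
         + \<mu>1 * ((\<mu>1 - \<mu>2) / (L - \<mu>2)) * (1/2 * (norm (x1 - x2))\<^sup>2)) L2)"
proof -
  have "0 \<le> \<mu>1" and f1: "f1 \<in> curvature_class \<mu>1 L1" and f2: "f2 \<in> curvature_class \<mu>2 L2"
    using assms(1) by (auto simp: standing_assumption_def)
  then have p1: "proper f1" and c1: "ereal_convex (\<lambda>x. f1 x - ereal (\<mu>1 / 2 * (norm x)\<^sup>2))"
    and p2: "proper f2" and c2: "ereal_convex (\<lambda>x. f2 x - ereal (\<mu>2 / 2 * (norm x)\<^sup>2))"
    by (auto simp: curvature_class_def)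
  obtain g0 where g0: "g0 \<in> convex_subdiff f2 x0" "g0 \<in> convex_subdiff f1 x1"
    using assms(4,6) is_arg_min_imp_convex_subdiff[OF p1]
    by (auto simp: dca_step_def subdiff_def)
  obtain g1 where g1: "g1 \<in> convex_subdiff f2 x1" "g1 \<in> convex_subdiff f1 x2"
    using assms(4,7) is_arg_min_imp_convex_subdiff[OF p1]
    by (auto simp: dca_step_def subdiff_def)
  \<comment> \<open>A subgradient at \<open>x0\<close> certifies that \<open>f1 x0\<close> is
    finite, so that the objective values compared below are real.\<close>
  obtain g where g: "g \<in> convex_subdiff f1 x0"
    using assms(5) \<open>0 \<le> \<mu>1\<close> by (auto simp: dom_subdiff_def subdiff_def)
  obtain a0 a1 b0 b1 where
    fx: "f1 x0 = ereal a0" "f1 x1 = ereal a1" "f2 x0 = ereal b0" "f2 x1 = ereal b1"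
    using convex_subdiff_finite[OF p1 g] convex_subdiff_finite[OF p1 g0(2)]
      convex_subdiff_finite[OF p2 g0(1)] convex_subdiff_finite[OF p2 g1(1)] by auto
  define A where "A = (norm (x1 - x0))\<^sup>2"
  have descent1: "a1 + g0 \<bullet> (x0 - x1) + \<mu>1 / 2 * A \<le> a0"
    using strongly_convex_subgradient_ineq[OF p1 c1 g0(2), of x0]
    unfolding fx A_def by (simp add: norm_minus_commute)
  have obj: "dc_objective f1 f2 x0 - dc_objective f1 f2 x1 = ereal ((a0 - b0) - (a1 - b1))"
    by (simp add: dc_objective_def fx)
  have flip: "g0 \<bullet> (x0 - x1) = - (g0 \<bullet> (x1 - x0))" by (simp add: inner_diff_right)
  show ?thesis
  proof (cases L2)
    case PInf
    \<comment> \<open>In the limit the coefficients become \<open>\<mu>1 + \<mu>2\<close> and 0, so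
      strong convexity of both functions along the first step suffices.\<close>
    have "b0 + g0 \<bullet> (x1 - x0) + \<mu>2 / 2 * A \<le> b1"
      using strongly_convex_subgradient_ineq[OF p2 c2 g0(1), of x1] unfolding fx A_def by simp
    then have "(\<mu>1 + \<mu>2) * (1/2 * A) \<le> (a0 - b0) - (a1 - b1)"
      using descent1 flip by (simp add: algebra_simps add_divide_distrib)
    moreover have "((\<lambda>L. (\<mu>1 + \<mu>2 * ((L - \<mu>1) / (L - \<mu>2))) * (1/2 * A)
         + \<mu>1 * ((\<mu>1 - \<mu>2) / (L - \<mu>2)) * (1/2 * (norm (x1 - x2))\<^sup>2))
         \<longlongrightarrow> (\<mu>1 + \<mu>2 * 1) * (1/2 * A) + \<mu>1 * 0 * (1/2 * (norm (x1 - x2))\<^sup>2)) at_top"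
      by (intro tendsto_intros) real_asymp+
    ultimately show ?thesis
      unfolding obj PInf A_def by (simp add: curvature_eval_infinity norm_minus_commute)
  next
    case (real L)
    then have "\<mu>1 < L" "\<mu>2 < L" using assms(2,3) by auto
    define M where "M = L - \<mu>2"
    have "M > 0" using \<open>\<mu>2 < L\<close> by (simp add: M_def)
    define E where "E = (norm (g1 - g0 - \<mu>2 *\<^sub>R (x1 - x0)))\<^sup>2"
    define B where "B = (norm (x2 - x1))\<^sup>2"
    have "b0 + g0 \<bullet> (x1 - x0) + \<mu>2 / 2 * A + E / (2 * M) \<le> b1"
      using curvature_class_interpolation_ineq[OF f2[unfolded real] \<open>\<mu>2 < L\<close> g0(1) g1(1)]
      unfolding fx A_def E_def M_def by (simp add: add.assoc)
    then have "(\<mu>1 + \<mu>2) * (1/2 * A) + E / (2 * M) \<le> (a0 - b0) - (a1 - b1)"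
      using descent1 flip by (simp add: algebra_simps add_divide_distrib)
    \<comment> \<open>The interpolation surplus \<open>E\<close> is traded for the second step
      length \<open>B\<close>, at the cost of a multiple of \<open>A\<close>.\<close>
    moreover have "\<mu>1 * (\<mu>1 - \<mu>2) * B \<le> E + \<mu>2 * (\<mu>1 - \<mu>2) * A"
      unfolding A_def B_def E_def
      using assms(3,4) strongly_convex_subgradient_expansion[OF p1 c1 g0(2) g1(2)]
      by (intro norm_diff_scaled_sq_lower_bound) auto
    then have "\<mu>1 * (\<mu>1 - \<mu>2) * B / (2 * M) \<le> (E + \<mu>2 * (\<mu>1 - \<mu>2) * A) / (2 * M)"
      using \<open>M > 0\<close> by (intro divide_right_mono) auto
    \<comment> \<open>That cost, divided by \<open>2 * M\<close>, lowers the coefficient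
      \<open>\<mu>2\<close> of \<open>1/2 * A\<close> to
      \<open>\<mu>2 * ((L - \<mu>1) / (L - \<mu>2))\<close>.\<close>
    moreover have "(L - \<mu>1) / (L - \<mu>2) = 1 - (\<mu>1 - \<mu>2) / M"
      using \<open>M > 0\<close> by (simp add: M_def field_simps)
    ultimately have "(\<mu>1 + \<mu>2 * ((L - \<mu>1) / (L - \<mu>2))) * (1/2 * A)
         + \<mu>1 * ((\<mu>1 - \<mu>2) / (L - \<mu>2)) * (1/2 * B) \<le> (a0 - b0) - (a1 - b1)"
      by (simp add: M_def[symmetric] algebra_simps add_divide_distrib diff_divide_distrib)
    then show ?thesis
      unfolding obj real A_def B_def by (simp add: norm_minus_commute)
  qed (use assms(2) in simp)
qed

end
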